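(* Let $n\ge1$ and $A=(a_{ij})\in\mathrm{CSP}_{\mathbb{Z}}(n)$. Write $S_j=\sum_{i=0}^{n-1}a_{ij}$ for the column sums of $A$, $j=1,\dots,n$, and set $\mathbf{s}=(S_1,\dots,S_n)$. Then there exist swaps $\delta_1(\mathbf{u}_r,\mathbf{v}_r)$, $r=1,\dots,t$, such that $$A=U(\mathbf{s})+\sum_{r=1}^t\delta_1(\mathbf{u}_r,\mathbf{v}_r).$$ Moreover $U(\mathbf{s})+\sum_{r=1}^{t_0}\delta_1(\mathbf{u}_r,\mathbf{v}_r)\in\mathrm{CSP}_{\mathbb{Z}}(n)$ for all $1\le t_0\le t$.
   Context: Rows of $n\times n$ matrices are indexed by $i=0,\dots,n-1$ and columns by $j=1,\dots,n$. Let $\omega_n$ be a primitive $n$-th root of unity. A matrix $A=(a_{ij})\in\mathbb{R}_{\ge 0}^{n\times n}$ is a CSP-matrix if for each $1\le k\le n$, $$\sum_{\substack{0\le i<n\\1\le j\le n}}a_{ij}\,\omega_n^{ki}=\sum_{0\le i<n}\ \sum_{j\mid k}a_{ij}.$$ $\mathrm{CSP}(n)$ is the set of all $n\times n$ CSP-matrices and $\mathrm{CSP}_{\mathbb{Z}}(n)=\mathrm{CSP}(n)\cap\mathbb{Z}^{n\times n}$. For $a\in\mathbb{R}$ and index pairs $\mathbf{u}=(u_1,u_2)$, $\mathbf{v}=(v_1,v_2)$, the swap is $\delta_a(\mathbf{u},\mathbf{v})=a(E_{u_1u_2}+E_{v_1v_2}-E_{v_1u_2}-E_{u_1v_2})$,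 where $E_{ij}$ are the standard basis matrices. $U(\mathbf{s})$ is the universal CSP-matrix with column sums $S_1,\dots,S_n$: its $(i,j)$ entry is $S_j/j$ if $j\mid n$ and $i\equiv 0\pmod{n/j}$, and $0$ otherwise. *)

theory Defs
  imports Complex_Main "HOL-Library.Function_Algebras" "HOL-Number_Theory.Cong"
begin

definition primitive_root_of_unity :: "nat \<Rightarrow> complex \<Rightarrow> bool" where
  "primitive_root_of_unity n \<omega> \<longleftrightarrow> \<omega> ^ n = 1 \<and> (\<forall>m. 0 < m \<and> m < n \<longrightarrow> \<omega> ^ m \<noteq> 1)"

definition indices :: "nat \<Rightarrow> (nat \<times> nat) set" where
  "indices n = {0..<n} \<times> {1..n}"

text \<open>An \<open>n \<times> n\<close> matrix is a function of two indices that vanishes outside \<open>indices n\<close>, so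
  that equality of matrices is equality of functions and matrix addition is the pointwise
  addition of \<open>Function_Algebras\<close>.\<close>

definition square_matrices :: "nat \<Rightarrow> (nat \<Rightarrow> nat \<Rightarrow> real) set" where
  "square_matrices n = {A. \<forall>i j. (i, j) \<notin> indices n \<longrightarrow> A i j = 0}"

definition CSP :: "nat \<Rightarrow> complex \<Rightarrow> (nat \<Rightarrow> nat \<Rightarrow> real) set" where
  "CSP n \<omega> = {A \<in> square_matrices n.
     (\<forall>(i, j) \<in> indices n. A i j \<ge> 0) \<and>
     (\<forall>k \<in> {1..n}.
        (\<Sum>(i, j) \<in> indices n. complex_of_real (A i j) * \<omega> ^ (k * i)) =
        complex_of_real (\<Sum>i \<in> {0..<n}. \<Sum>j | j \<in> {1..n} \<and> j dvd k. A i j))}"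

definition CSP_int :: "nat \<Rightarrow> complex \<Rightarrow> (nat \<Rightarrow> nat \<Rightarrow> real) set" where
  "CSP_int n \<omega> = CSP n \<omega> \<inter> {A. \<forall>(i, j) \<in> indices n. A i j \<in> \<int>}"

definition column_sum :: "nat \<Rightarrow> (nat \<Rightarrow> nat \<Rightarrow> real) \<Rightarrow> nat \<Rightarrow> real" where
  "column_sum n A j = (\<Sum>i \<in> {0..<n}. A i j)"

definition matrix_unit :: "nat \<Rightarrow> nat \<Rightarrow> nat \<Rightarrow> nat \<Rightarrow> real" where
  "matrix_unit p q = (\<lambda>i j. if i = p \<and> j = q then 1 else 0)"

definition swap_matrix :: "real \<Rightarrow> nat \<times> nat \<Rightarrow> nat \<times> nat \<Rightarrow> nat \<Rightarrow> nat \<Rightarrow> real" where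
  "swap_matrix a u v = (\<lambda>i j. a *
     (matrix_unit (fst u) (snd u) i j + matrix_unit (fst v) (snd v) i j
      - matrix_unit (fst v) (snd u) i j - matrix_unit (fst u) (snd v) i j))"

text \<open>Only the values \<open>S 1, \<dots>, S n\<close> of \<open>S\<close> matter.\<close>

definition universal_matrix :: "nat \<Rightarrow> (nat \<Rightarrow> real) \<Rightarrow> nat \<Rightarrow> nat \<Rightarrow> real" where
  "universal_matrix n S = (\<lambda>i j.
     if (i, j) \<in> indices n \<and> j dvd n \<and> [i = 0] (mod (n div j)) then S j / real j else 0)"

end

theory Submission
  imports Defs
begin

text \<open>
  The CSP condition sees a matrix only through its margins, that is, its row sums and column sums
  (\<open>CSP_int_iff_margins\<close>). Swaps leave the margins alone, so a sequence of swaps that starts at a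
  CSP-matrix stays inside the set as long as no entry becomes negative. The statement therefore
  splits into two independent facts.

  The first is that \<open>A\<close> and \<open>U(s)\<close> have the same margins and that \<open>U(s)\<close> is integral. Comparing the
  CSP condition at \<open>k = n\<close> with the total of all entries shows that the columns \<open>j\<close> not dividing
  \<open>n\<close> sum to zero (\<open>column_sum_eq_0_if_not_dvd\<close>). The CSP condition prescribes the discrete Fourier
  transform of the row sums, so inverting it expresses row sum \<open>i\<close> as the sum of \<open>S j / j\<close> over the
  divisors \<open>j\<close> of \<open>n\<close> with \<open>n / j\<close> dividing \<open>i\<close> (\<open>row_sum_CSP_int\<close>), which is what one reads off
  \<open>U(s)\<close>. At \<open>i = n / j\<close> the sum runs over the multiples of \<open>j\<close> dividing \<open>n\<close>, a triangular
  system in the unknowns \<open>S j / j\<close>; as row sums of \<open>A\<close> are integers, so are its solutions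
  (\<open>column_sum_div_Ints\<close>).

  The second is that any two matrices of natural numbers with equal margins are connected by unit
  swaps through such matrices (\<open>swap_connected\<close>). Where \<open>X\<close> exceeds \<open>A\<close>, equality of
  the margins yields a deficient entry in the same row and then an excessive entry in the column of
  that one; the swap on the rectangle spanned by the three brings all of them closer to \<open>A\<close> and
  can harm only the fourth corner, so the distance drops by at least two
  (\<open>exists_swap_reducing_dist\<close>).
\<close>

section \<open>Sums of powers of a root of unity\<close>

lemma sum_powers_root_of_unity:
  fixes z :: complex
  assumes "z ^ d = 1"
  shows "(\<Sum>k = 1..d. z ^ k) = (if z = 1 then of_nat d else 0)"
proof (cases "z = 1")
  case False
  have "(\<Sum>k = 1..d. z ^ k) = z * (\<Sum>k < d. z ^ k)"
    unfolding sum_distrib_left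
    by (rule sum.reindex_bij_witness[of _ Suc "\<lambda>k. k - 1"]) (auto simp flip: power_Suc)
  also have "(\<Sum>k < d. z ^ k) = 0"
    using False assms by (simp add: geometric_sum)
  finally show ?thesis using False by simp
qed simp

lemma primitive_root_power_eq_1_iff:
  assumes "primitive_root_of_unity n \<omega>" and "n \<ge> 1"
  shows "\<omega> ^ m = 1 \<longleftrightarrow> n dvd m"
proof -
  have "\<omega> ^ m = \<omega> ^ (n * (m div n) + m mod n)" by simp
  also have "\<dots> = \<omega> ^ (m mod n)"
    using assms(1) unfolding primitive_root_of_unity_def power_add power_mult by simp
  finally have red: "\<omega> ^ m = \<omega> ^ (m mod n)" .
  have "m mod n < n" using assms(2) by simp
  then have "\<omega> ^ (m mod n) = 1 \<longleftrightarrow> m mod n = 0"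
    using assms(1) unfolding primitive_root_of_unity_def by (metis gr0I power_0)
  then show ?thesis using red by (simp add: mod_eq_0_iff_dvd)
qed

text \<open>The factor \<open>\<omega> ^ (k * (n - i0))\<close> is the conjugate character \<open>\<omega> ^ (- k * i0)\<close>, written so that
  exponents stay natural numbers. After exchanging the sums this is orthogonality of characters.\<close>

lemma fourier_inversion:
  fixes R :: "nat \<Rightarrow> complex"
  assumes "primitive_root_of_unity n \<omega>" and "i0 < n"
  shows "(\<Sum>k = 1..n. \<omega> ^ (k * (n - i0)) * (\<Sum>i = 0..<n. R i * \<omega> ^ (k * i))) = of_nat n * R i0"
proof -
  have w: "(\<omega> ^ (n - i0 + i)) ^ n = 1" for i
    using assms(1) by (metis primitive_root_of_unity_def mult.commute power_mult power_one)
  have one: "\<omega> ^ (n - i0 + i) = 1 \<longleftrightarrow> i = i0" if "i < n" for i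
  proof -
    have "n dvd n - i0 + i \<longleftrightarrow> i = i0"
    proof
      assume "n dvd n - i0 + i"
      then obtain q where q: "n - i0 + i = n * q" by blast
      have "0 < n * q" "n * q < n * 2" using q that assms(2) by linarith+
      then have "q = 1" by (cases q) auto
      then show "i = i0" using q assms(2) by simp
    qed (use assms(2) in simp)
    then show ?thesis using primitive_root_power_eq_1_iff[OF assms(1)] assms(2) by simp
  qed
  have orth: "(\<Sum>k = 1..n. (\<omega> ^ (n - i0 + i)) ^ k) = (if i = i0 then of_nat n else 0)" if "i < n" for i
    by (simp only: sum_powers_root_of_unity[OF w] one[OF that])
  have "(\<Sum>k = 1..n. \<omega> ^ (k * (n - i0)) * (\<Sum>i = 0..<n. R i * \<omega> ^ (k * i)))
      = (\<Sum>k = 1..n. \<Sum>i = 0..<n. R i * (\<omega> ^ (n - i0 + i)) ^ k)"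
    unfolding sum_distrib_left
    by (intro sum.cong refl) (simp add: power_add power_mult_distrib mult.commute flip: power_mult)
  also have "\<dots> = (\<Sum>i = 0..<n. R i * (\<Sum>k = 1..n. (\<omega> ^ (n - i0 + i)) ^ k))"
    unfolding sum_distrib_left by (rule sum.swap)
  also have "\<dots> = (\<Sum>i = 0..<n. if i = i0 then of_nat n * R i0 else 0)"
    by (intro sum.cong refl) (simp add: orth del: One_nat_def)
  finally show ?thesis using assms(2) by simp
qed

section \<open>The CSP condition is a condition on the margins\<close>

definition row_sum :: "nat \<Rightarrow> (nat \<Rightarrow> nat \<Rightarrow> real) \<Rightarrow> nat \<Rightarrow> real" where
  "row_sum n A i = (\<Sum>j \<in> {1..n}. A i j)"

text \<open>Entries remain of type \<^typ>\<open>real\<close>, so that these matrices are literally elements of the ambient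
  set of CSP-matrices.\<close>

definition nat_matrices :: "nat \<Rightarrow> (nat \<Rightarrow> nat \<Rightarrow> real) set" where
  "nat_matrices n = {A \<in> square_matrices n. \<forall>(i, j) \<in> indices n. A i j \<ge> 0 \<and> A i j \<in> \<int>}"

definition same_margins :: "nat \<Rightarrow> (nat \<Rightarrow> nat \<Rightarrow> real) \<Rightarrow> (nat \<Rightarrow> nat \<Rightarrow> real) \<Rightarrow> bool" where
  "same_margins n A B \<longleftrightarrow>
     (\<forall>i < n. row_sum n A i = row_sum n B i) \<and> (\<forall>j \<in> {1..n}. column_sum n A j = column_sum n B j)"

lemma CSP_int_iff_margins:
  "A \<in> CSP_int n \<omega> \<longleftrightarrow> A \<in> nat_matrices n \<and>
     (\<forall>k \<in> {1..n}. (\<Sum>i = 0..<n. complex_of_real (row_sum n A i) * \<omega> ^ (k * i)) =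
        complex_of_real (\<Sum>j | j \<in> {1..n} \<and> j dvd k. column_sum n A j))"
proof -
  have "(\<Sum>(i, j) \<in> indices n. complex_of_real (A i j) * \<omega> ^ (k * i))
      = (\<Sum>i = 0..<n. complex_of_real (row_sum n A i) * \<omega> ^ (k * i))" for k
    unfolding indices_def row_sum_def
    by (simp add: sum.cartesian_product[symmetric] sum_distrib_right)
  moreover have "(\<Sum>i \<in> {0..<n}. \<Sum>j | j \<in> {1..n} \<and> j dvd k. A i j)
      = (\<Sum>j | j \<in> {1..n} \<and> j dvd k. column_sum n A j)" for k
    unfolding column_sum_def by (rule sum.swap)
  ultimately show ?thesis
    unfolding CSP_int_def CSP_def nat_matrices_def by (auto simp del: of_real_sum)
qed

lemma CSP_int_same_margins:
  assumes "A \<in> CSP_int n \<omega>" and "B \<in> nat_matrices n" and "same_margins n A B"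
  shows "B \<in> CSP_int n \<omega>"
proof -
  have "(\<Sum>i = 0..<n. complex_of_real (row_sum n B i) * \<omega> ^ (k * i))
      = (\<Sum>i = 0..<n. complex_of_real (row_sum n A i) * \<omega> ^ (k * i))" for k
    using assms(3) by (intro sum.cong) (auto simp: same_margins_def)
  moreover have "(\<Sum>j | j \<in> {1..n} \<and> j dvd k. column_sum n B j)
      = (\<Sum>j | j \<in> {1..n} \<and> j dvd k. column_sum n A j)" for k
    using assms(3) by (intro sum.cong) (auto simp: same_margins_def)
  ultimately show ?thesis using assms(1,2) unfolding CSP_int_iff_margins by simp
qed

section \<open>Margins of a CSP-matrix\<close>

lemma column_sum_nonneg:
  assumes "A \<in> nat_matrices n" and "j \<in> {1..n}"
  shows "column_sum n A j \<ge> 0"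
  using assms unfolding column_sum_def nat_matrices_def indices_def by (auto intro!: sum_nonneg)

lemma sum_column_sums_eq_sum_row_sums:
  "(\<Sum>j = 1..n. column_sum n A j) = (\<Sum>i = 0..<n. row_sum n A i)"
  unfolding column_sum_def row_sum_def by (rule sum.swap)

text \<open>At \<open>k = n\<close> every power of \<open>\<omega>\<close> is one, and the CSP condition says that the columns whose index
  divides \<open>n\<close> already carry the total of all entries. Nonnegativity leaves nothing for the others.\<close>

lemma column_sum_eq_0_if_not_dvd:
  assumes "primitive_root_of_unity n \<omega>" and A: "A \<in> CSP_int n \<omega>"
    and j: "j \<in> {1..n}" "\<not> j dvd n"
  shows "column_sum n A j = 0"
proof -
  let ?S = "column_sum n A"
  have w: "\<omega> ^ (n * i) = 1" for i
    using assms(1) by (simp add: primitive_root_of_unity_def power_mult)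
  have "n \<in> {1..n}" using j by auto
  then have "(\<Sum>i = 0..<n. complex_of_real (row_sum n A i) * \<omega> ^ (n * i))
      = complex_of_real (\<Sum>j | j \<in> {1..n} \<and> j dvd n. ?S j)"
    using A unfolding CSP_int_iff_margins by blast
  then have "complex_of_real (\<Sum>i = 0..<n. row_sum n A i)
      = complex_of_real (\<Sum>j | j \<in> {1..n} \<and> j dvd n. ?S j)"
    by (simp only: w mult_1_right of_real_sum)
  then have eq: "(\<Sum>j = 1..n. ?S j) = (\<Sum>j | j \<in> {1..n} \<and> j dvd n. ?S j)"
    unfolding sum_column_sums_eq_sum_row_sums of_real_eq_iff .
  have part: "{1..n} = {j \<in> {1..n}. j dvd n} \<union> {j \<in> {1..n}. \<not> j dvd n}" by auto
  have "(\<Sum>j = 1..n. ?S j)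
      = (\<Sum>j | j \<in> {1..n} \<and> j dvd n. ?S j) + (\<Sum>j | j \<in> {1..n} \<and> \<not> j dvd n. ?S j)"
    by (subst part, subst sum.union_disjoint) auto
  with eq have "(\<Sum>j | j \<in> {1..n} \<and> \<not> j dvd n. ?S j) = 0" by simp
  moreover have "A \<in> nat_matrices n" using A by (simp add: CSP_int_iff_margins)
  ultimately show ?thesis
    using j by (subst (asm) sum_nonneg_eq_0_iff) (auto intro: column_sum_nonneg)
qed

text \<open>Fourier inversion of the CSP condition. The function \<open>k \<mapsto> (\<Sum>j dvd k. S j)\<close> is a combination of
  the indicators of the subgroups \<open>j \<int> / n \<int>\<close>, and the transform of such an indicator is a multiple
  of the indicator of the annihilator, the subgroup generated by \<open>n / j\<close>.\<close>

lemma row_sum_CSP_int: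
  assumes \<omega>: "primitive_root_of_unity n \<omega>" and A: "A \<in> CSP_int n \<omega>" and i: "i < n"
  shows "row_sum n A i = (\<Sum>j | j dvd n \<and> n div j dvd i. column_sum n A j / real j)"
proof -
  let ?S = "column_sum n A"
  have n: "n \<ge> 1" using i by simp
  \<comment> \<open>the transform of the indicator of the multiples of \<open>j\<close>\<close>
  have inner: "(\<Sum>k | k \<in> {1..n} \<and> j dvd k. \<omega> ^ (k * (n - i)))
      = (if n div j dvd i then of_nat (n div j) else 0)" if j: "j dvd n" for j
  proof -
    obtain d where d: "n = j * d" using j by blast
    have jd: "j > 0" "d > 0" using d n by (auto intro: gr0I)
    have reindex: "(\<Sum>k | k \<in> {1..n} \<and> j dvd k. \<omega> ^ (k * (n - i)))
        = (\<Sum>m = 1..d. (\<omega> ^ (j * (n - i))) ^ m)"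
      by (rule sum.reindex_bij_witness[of _ "\<lambda>m. j * m" "\<lambda>k. k div j"])
        (use jd in \<open>auto simp: d Suc_le_eq mult.assoc mult.commute mult.left_commute
            simp flip: power_mult elim!: dvdE\<close>)
    have root: "(\<omega> ^ (j * (n - i))) ^ d = 1"
    proof -
      have "(\<omega> ^ (j * (n - i))) ^ d = (\<omega> ^ n) ^ (n - i)"
        by (simp only: d power_mult[symmetric] mult_ac)
      then show ?thesis using \<omega> by (simp add: primitive_root_of_unity_def)
    qed
    have trivial: "\<omega> ^ (j * (n - i)) = 1 \<longleftrightarrow> d dvd i"
    proof -
      have "d dvd n - i \<longleftrightarrow> d dvd i"
        using i d by (metis dvd_diff_nat dvd_triv_right diff_diff_cancel less_imp_le)
      then show ?thesis
        using primitive_root_power_eq_1_iff[OF \<omega> n] jd by (simp add: d)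
    qed
    have "n div j = d" using jd by (simp add: d)
    then show ?thesis by (simp only: reindex sum_powers_root_of_unity[OF root] trivial)
  qed
  have f: "(\<Sum>i = 0..<n. complex_of_real (row_sum n A i) * \<omega> ^ (k * i))
      = (\<Sum>j | j dvd n. if j dvd k then complex_of_real (?S j) else 0)" if k: "k \<in> {1..n}" for k
  proof -
    have "(\<Sum>j | j \<in> {1..n} \<and> j dvd k. ?S j) = (\<Sum>j | j dvd n \<and> j dvd k. ?S j)"
      using column_sum_eq_0_if_not_dvd[OF \<omega> A] n
      by (intro sum.mono_neutral_right) (auto dest: dvd_imp_le simp: Suc_le_eq intro: dvd_pos_nat)
    also have "\<dots> = (\<Sum>j | j dvd n. if j dvd k then ?S j else 0)"
      using n by (simp add: sum.If_cases Int_def flip: Collect_conj_eq)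
    finally have eq: "(\<Sum>j | j \<in> {1..n} \<and> j dvd k. ?S j) = (\<Sum>j | j dvd n. if j dvd k then ?S j else 0)" .
    have "(\<Sum>i = 0..<n. complex_of_real (row_sum n A i) * \<omega> ^ (k * i))
        = complex_of_real (\<Sum>j | j \<in> {1..n} \<and> j dvd k. ?S j)"
      using A k unfolding CSP_int_iff_margins by blast
    then show ?thesis unfolding eq by (simp add: if_distrib cong: if_cong)
  qed
  have "complex_of_real (real n * row_sum n A i)
      = (\<Sum>k = 1..n. \<omega> ^ (k * (n - i)) * (\<Sum>j | j dvd n. if j dvd k then complex_of_real (?S j) else 0))"
    using fourier_inversion[OF \<omega> i, of "\<lambda>i. complex_of_real (row_sum n A i)"] f by simp
  also have "\<dots> = (\<Sum>k = 1..n. \<Sum>j | j dvd n. if j dvd k then complex_of_real (?S j) * \<omega> ^ (k * (n - i)) else 0)"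
    unfolding sum_distrib_left by (intro sum.cong refl) (simp add: mult.commute)
  also have "\<dots> = (\<Sum>j | j dvd n. \<Sum>k = 1..n. if j dvd k then complex_of_real (?S j) * \<omega> ^ (k * (n - i)) else 0)"
    by (rule sum.swap)
  also have "\<dots> = (\<Sum>j | j dvd n. complex_of_real (?S j) * (\<Sum>k | k \<in> {1..n} \<and> j dvd k. \<omega> ^ (k * (n - i))))"
    unfolding sum_distrib_left
    by (simp only: sum.inter_filter[OF finite_atLeastAtMost])
  also have "\<dots> = (\<Sum>j | j dvd n. if n div j dvd i then complex_of_real (real n * (?S j / real j)) else 0)"
  proof (intro sum.cong refl)
    fix j assume "j \<in> {j. j dvd n}"
    then have j: "j dvd n" by simp
    have "complex_of_nat (n div j) = complex_of_real (real n / real j)"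
      by (simp flip: real_of_nat_div[OF j])
    then show "complex_of_real (?S j) * (\<Sum>k | k \<in> {1..n} \<and> j dvd k. \<omega> ^ (k * (n - i)))
        = (if n div j dvd i then complex_of_real (real n * (?S j / real j)) else 0)"
      by (simp only: inner[OF j] mult_zero_right flip: of_real_mult cong: if_cong) simp
  qed
  also have "\<dots> = (\<Sum>j | j dvd n \<and> n div j dvd i. complex_of_real (real n * (?S j / real j)))"
    using n by (simp add: sum.If_cases Int_def flip: Collect_conj_eq)
  also have "\<dots> = complex_of_real (real n * (\<Sum>j | j dvd n \<and> n div j dvd i. ?S j / real j))"
    by (simp add: sum_distrib_left)
  finally show ?thesis using n by (subst (asm) of_real_eq_iff) simp
qed

text \<open>For divisors \<open>d\<close> of \<open>n\<close>, \<open>n / d\<close> divides \<open>n / j\<close> exactly when \<open>j\<close> divides \<open>d\<close>. So row sum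
  \<open>n / j\<close> is \<open>S j / j\<close> plus the quotients \<open>S d / d\<close> of proper multiples \<open>d\<close> of \<open>j\<close>, and descending
  induction on \<open>j\<close> applies.\<close>

lemma column_sum_div_Ints:
  assumes \<omega>: "primitive_root_of_unity n \<omega>" and A: "A \<in> CSP_int n \<omega>" and n: "n \<ge> 1"
    and "j dvd n"
  shows "column_sum n A j / real j \<in> \<int>"
  using \<open>j dvd n\<close>
proof (induction "n - j" arbitrary: j rule: less_induct)
  case less
  let ?q = "\<lambda>d. column_sum n A d / real d"
  have j: "j > 0" using less.prems n by (auto intro: dvd_pos_nat)
  \<comment> \<open>rows are numbered from \<open>0\<close> to \<open>n - 1\<close>; for \<open>j = 1\<close> the row \<open>n / j\<close> is row \<open>0\<close>\<close>
  define i where "i = n div j mod n"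
  have i: "i < n" using n by (simp add: i_def)
  have dvd: "n div d dvd i \<longleftrightarrow> j dvd d" if d: "d dvd n" for d
  proof -
    obtain a where a: "n = d * a" using d by blast
    obtain b where b: "n = j * b" using less.prems by blast
    have "n div d dvd i \<longleftrightarrow> a dvd b"
    proof -
      have "n div d = a" using n a by auto
      moreover have "n div j = b" using j b by simp
      moreover have "a dvd n" using a by simp
      ultimately show ?thesis unfolding i_def by (simp add: dvd_mod_iff)
    qed
    also have "\<dots> \<longleftrightarrow> j dvd d"
    proof
      assume "a dvd b"
      then obtain c where "b = a * c" by blast
      then have "d * a = j * c * a" using a b by (metis mult.assoc mult.commute)
      moreover have "a > 0" using a n by (auto intro: gr0I)
      ultimately have "d = j * c" by simp
      then show "j dvd d" by simp
    next
      assume "j dvd d"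
      then obtain c where "d = j * c" by blast
      then have "j * b = j * (c * a)" using a b by (simp add: ac_simps)
      then show "a dvd b" using j by auto
    qed
    finally show ?thesis .
  qed
  have "A \<in> nat_matrices n" using A by (simp add: CSP_int_iff_margins)
  then have int: "row_sum n A i \<in> \<int>"
    unfolding row_sum_def nat_matrices_def indices_def using i by (auto intro!: Ints_sum)
  have "row_sum n A i = (\<Sum>d | d dvd n \<and> j dvd d. ?q d)"
    unfolding row_sum_CSP_int[OF \<omega> A i] by (intro sum.cong) (auto simp: dvd)
  also have "\<dots> = ?q j + (\<Sum>d \<in> {d. d dvd n \<and> j dvd d} - {j}. ?q d)"
    using less.prems n by (intro sum.remove) auto
  finally have "?q j = row_sum n A i - (\<Sum>d \<in> {d. d dvd n \<and> j dvd d} - {j}. ?q d)" by simp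
  moreover have "(\<Sum>d \<in> {d. d dvd n \<and> j dvd d} - {j}. ?q d) \<in> \<int>"
  proof (rule Ints_sum)
    fix d assume d: "d \<in> {d. d dvd n \<and> j dvd d} - {j}"
    then have "d \<le> n" using n by (auto intro: dvd_imp_le)
    moreover have "d > 0" using d n by (auto intro: dvd_pos_nat)
    then have "j \<le> d" using d by (simp add: dvd_imp_le)
    then have "j < d" using d by auto
    ultimately have lt: "n - d < n - j" by simp
    then show "?q d \<in> \<int>" using less.hyps[OF lt] d by simp
  qed
  ultimately show ?case using int by simp
qed

section \<open>The universal matrix\<close>

text \<open>The row sums of the universal matrix are the expression in \<open>row_sum_CSP_int\<close>. In a column \<open>j\<close>
  dividing \<open>n\<close>, the entry \<open>S j / j\<close> appears in the \<open>j\<close> rows that are multiples of \<open>n / j\<close>; in the other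
  columns \<open>A\<close> sums to zero as well.\<close>

lemma universal_matrix_same_margins:
  assumes \<omega>: "primitive_root_of_unity n \<omega>" and A: "A \<in> CSP_int n \<omega>"
  shows "same_margins n A (universal_matrix n (column_sum n A))"
  unfolding same_margins_def
proof (intro conjI allI impI ballI)
  fix i assume i: "i < n"
  show "row_sum n A i = row_sum n (universal_matrix n (column_sum n A)) i"
    unfolding row_sum_CSP_int[OF \<omega> A i] row_sum_def[of n "universal_matrix _ _"]
    by (rule sum.mono_neutral_cong_left)
      (use i in \<open>auto simp: universal_matrix_def indices_def cong_0_iff Suc_le_eq dvd_imp_le intro!: gr0I\<close>)
next
  fix j assume j: "j \<in> {1..n}"
  show "column_sum n A j = column_sum n (universal_matrix n (column_sum n A)) j"
  proof (cases "j dvd n")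
    case False
    then have "universal_matrix n (column_sum n A) i j = 0" for i by (simp add: universal_matrix_def)
    then show ?thesis
      using column_sum_eq_0_if_not_dvd[OF \<omega> A j False]
      by (simp add: column_sum_def[of n "universal_matrix n (column_sum n A)"])
  next
    case True
    then obtain d where d: "n = j * d" by blast
    have pos: "j > 0" "d > 0" using d j by (auto intro: gr0I)
    have "{i \<in> {0..<n}. d dvd i} = (\<lambda>m. d * m) ` {0..<j}"
      using pos by (auto simp: d mult.commute elim!: dvdE)
    then have "card {i \<in> {0..<n}. d dvd i} = j"
      using pos by (simp add: card_image inj_on_def)
    moreover have "column_sum n (universal_matrix n (column_sum n A)) j
        = (\<Sum>i \<in> {i \<in> {0..<n}. d dvd i}. column_sum n A j / real j)"
      unfolding column_sum_def[of n "universal_matrix _ _"]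
      by (rule sum.mono_neutral_cong_right)
        (use j pos d in \<open>auto simp: universal_matrix_def indices_def cong_0_iff\<close>)
    ultimately show ?thesis using pos by simp
  qed
qed

lemma universal_matrix_nat_matrices:
  assumes "primitive_root_of_unity n \<omega>" and A: "A \<in> CSP_int n \<omega>" and "n \<ge> 1"
  shows "universal_matrix n (column_sum n A) \<in> nat_matrices n"
proof -
  have "A \<in> nat_matrices n" using A by (simp add: CSP_int_iff_margins)
  then show ?thesis
    using column_sum_div_Ints[OF assms] column_sum_nonneg
    by (auto simp: nat_matrices_def square_matrices_def universal_matrix_def indices_def)
qed

section \<open>Connecting matrices with equal margins by swaps\<close>

lemma sum_matrix_unit:
  assumes "(p, q) \<in> indices n"
  shows "column_sum n (matrix_unit p q) j = (if j = q then 1 else 0)"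
    and "row_sum n (matrix_unit p q) i = (if i = p then 1 else 0)"
    and "(\<Sum>(i, j) \<in> indices n. matrix_unit p q i j) = 1"
proof -
  show "column_sum n (matrix_unit p q) j = (if j = q then 1 else 0)"
    using assms by (cases "j = q") (simp_all add: column_sum_def matrix_unit_def indices_def)
  show row: "row_sum n (matrix_unit p q) i = (if i = p then 1 else 0)" for i
    using assms by (cases "i = p") (simp_all add: row_sum_def matrix_unit_def indices_def)
  have "(\<Sum>(i, j) \<in> indices n. matrix_unit p q i j) = (\<Sum>i = 0..<n. row_sum n (matrix_unit p q) i)"
    by (simp add: indices_def row_sum_def sum.cartesian_product)
  then show "(\<Sum>(i, j) \<in> indices n. matrix_unit p q i j) = 1"
    using assms by (simp add: row indices_def)
qed

lemma same_margins_swap: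
  assumes "u \<in> indices n" and "v \<in> indices n"
  shows "same_margins n X (X + swap_matrix 1 u v)"
proof -
  obtain a b c d where uv: "u = (a, b)" "v = (c, d)" by fastforce
  with assms have mem: "(a, b) \<in> indices n" "(c, d) \<in> indices n" "(c, b) \<in> indices n" "(a, d) \<in> indices n"
    by (auto simp: indices_def)
  have "column_sum n (X + swap_matrix 1 u v) j = column_sum n X j
      + (column_sum n (matrix_unit a b) j + column_sum n (matrix_unit c d) j
       - column_sum n (matrix_unit c b) j - column_sum n (matrix_unit a d) j)" for j
    by (simp add: uv column_sum_def swap_matrix_def sum.distrib sum_subtractf)
  moreover have "row_sum n (X + swap_matrix 1 u v) i = row_sum n X i
      + (row_sum n (matrix_unit a b) i + row_sum n (matrix_unit c d) i
       - row_sum n (matrix_unit c b) i - row_sum n (matrix_unit a d) i)" for i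
    by (simp add: uv row_sum_def swap_matrix_def sum.distrib sum_subtractf)
  ultimately show ?thesis
    using mem by (simp add: same_margins_def sum_matrix_unit)
qed

definition matrix_dist :: "nat \<Rightarrow> (nat \<Rightarrow> nat \<Rightarrow> real) \<Rightarrow> (nat \<Rightarrow> nat \<Rightarrow> real) \<Rightarrow> real" where
  "matrix_dist n X A = (\<Sum>(i, j) \<in> indices n. \<bar>X i j - A i j\<bar>)"

lemma Ints_less_imp_add1_le:
  fixes x y :: real
  assumes "x \<in> \<int>" "y \<in> \<int>" "x < y"
  shows "x + 1 \<le> y"
  using assms by (auto elim!: Ints_cases)

lemma exists_less_of_sum_eq:
  fixes f g :: "'a \<Rightarrow> real"
  assumes "finite I" "sum f I = sum g I" "k \<in> I" "f k < g k"
  shows "\<exists>l \<in> I. g l < f l"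
proof (rule ccontr)
  assume "\<not> ?thesis"
  then have "sum f I < sum g I"
    using assms by (intro sum_strict_mono_ex1) (auto simp: not_less)
  then show False using assms(2) by simp
qed

text \<open>Choose \<open>(i, j)\<close> with \<open>X > A\<close>, then \<open>(i, j')\<close> in its row with \<open>X < A\<close>, then \<open>(i', j')\<close> in the
  column of the latter with \<open>X > A\<close>. The swap lowers the two excessive entries, which are positive
  because they exceed entries of \<open>A\<close>. Three corners come closer to \<open>A\<close> by one and the corner \<open>(i', j)\<close>
  moves away by at most one.\<close>

lemma exists_swap_reducing_dist:
  assumes X: "X \<in> nat_matrices n" and A: "A \<in> nat_matrices n"
    and eq: "same_margins n X A" and "X \<noteq> A"
  shows "\<exists>u \<in> indices n. \<exists>v \<in> indices n. X + swap_matrix 1 u v \<in> nat_matrices n \<and>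
    matrix_dist n (X + swap_matrix 1 u v) A \<le> matrix_dist n X A - 2"
proof -
  have rows: "(\<Sum>j = 1..n. X i j) = (\<Sum>j = 1..n. A i j)" if "i < n" for i
    using eq that by (simp add: same_margins_def row_sum_def)
  have cols: "(\<Sum>i = 0..<n. X i j) = (\<Sum>i = 0..<n. A i j)" if "j \<in> {1..n}" for j
    using eq that by (simp add: same_margins_def column_sum_def)
  obtain i j0 where diff: "X i j0 \<noteq> A i j0" using \<open>X \<noteq> A\<close> by (metis ext)
  have "X i j0 = A i j0" if "(i, j0) \<notin> indices n"
    using X A that by (simp add: nat_matrices_def square_matrices_def)
  with diff have "(i, j0) \<in> indices n" by blast
  with diff have ij0: "i < n" "j0 \<in> {1..n}" "X i j0 \<noteq> A i j0"
    by (auto simp: indices_def)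
  obtain j where j: "j \<in> {1..n}" "A i j < X i j"
    using exists_less_of_sum_eq[OF _ rows[OF ij0(1)] ij0(2)] ij0 by (cases "X i j0 < A i j0") auto
  obtain j' where j': "j' \<in> {1..n}" "X i j' < A i j'"
    using exists_less_of_sum_eq[OF _ rows[OF ij0(1), symmetric] j(1) j(2)] by auto
  obtain i' where i': "i' < n" "A i' j' < X i' j'"
    using exists_less_of_sum_eq[OF _ cols[OF j'(1)], of i] j'(2) ij0(1) by auto
  have mem: "(i, j) \<in> indices n" "(i, j') \<in> indices n" "(i', j') \<in> indices n" "(i', j) \<in> indices n"
    using ij0(1) j(1) j'(1) i'(1) by (auto simp: indices_def)
  have ne: "i \<noteq> i'" "j \<noteq> j'" using j j' i' by auto
  have int: "X p q \<in> \<int>" "A p q \<in> \<int>" "X p q \<ge> 0" "A p q \<ge> 0" if "(p, q) \<in> indices n" for p q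
    using X A that by (auto simp: nat_matrices_def)
  \<comment> \<open>by integrality, moving one of these entries by one does not overshoot\<close>
  have gap: "A i j + 1 \<le> X i j" "X i j' + 1 \<le> A i j'" "A i' j' + 1 \<le> X i' j'"
    using mem int j j' i' by (auto intro!: Ints_less_imp_add1_le)
  let ?Y = "X + swap_matrix 1 (i, j') (i', j)"
  have Y: "?Y p q = X p q + (if p = i \<and> q = j' then 1 else 0) + (if p = i' \<and> q = j then 1 else 0)
       - (if p = i' \<and> q = j' then 1 else 0) - (if p = i \<and> q = j then 1 else 0)" for p q
    by (simp add: swap_matrix_def matrix_unit_def)
  have "?Y \<in> nat_matrices n"
    unfolding nat_matrices_def square_matrices_def
  proof (safe)
    fix p q assume "(p, q) \<notin> indices n"
    then show "?Y p q = 0"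
      using X mem unfolding Y nat_matrices_def square_matrices_def by auto
  next
    fix p q assume "(p, q) \<in> indices n"
    then show "0 \<le> ?Y p q" "?Y p q \<in> \<int>"
      using gap ne int(3,4)[of p q] int(4)[OF mem(1)] int(4)[OF mem(3)] int(1)[of p q]
      unfolding Y by auto
  qed
  moreover have "matrix_dist n ?Y A \<le> (\<Sum>(p, q) \<in> indices n. \<bar>X p q - A p q\<bar> + matrix_unit i' j p q
      - matrix_unit i j p q - matrix_unit i j' p q - matrix_unit i' j' p q)"
    unfolding matrix_dist_def
  proof (rule sum_mono, safe)
    fix p q
    show "\<bar>?Y p q - A p q\<bar> \<le> \<bar>X p q - A p q\<bar> + matrix_unit i' j p q
      - matrix_unit i j p q - matrix_unit i j' p q - matrix_unit i' j' p q"
      using gap ne unfolding Y matrix_unit_def by auto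
  qed
  moreover have "\<dots> = matrix_dist n X A - 2"
    using mem[THEN sum_matrix_unit(3)]
    by (simp add: matrix_dist_def case_prod_beta sum.distrib sum_subtractf)
  ultimately have "?Y \<in> nat_matrices n" "matrix_dist n ?Y A \<le> matrix_dist n X A - 2" by simp_all
  then show ?thesis using mem by blast
qed

definition swap_step :: "nat \<Rightarrow> ((nat \<Rightarrow> nat \<Rightarrow> real) \<times> (nat \<Rightarrow> nat \<Rightarrow> real)) set" where
  "swap_step n = {(X, Y).
     (\<exists>u \<in> indices n. \<exists>v \<in> indices n. Y = X + swap_matrix 1 u v) \<and> Y \<in> nat_matrices n}"

text \<open>Induction on the rounded-down distance, which is a natural number that strictly decreases since
  every reducing swap gains at least two.\<close>

lemma swap_connected:
  assumes "X \<in> nat_matrices n" and A: "A \<in> nat_matrices n" and "same_margins n X A"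
  shows "(X, A) \<in> (swap_step n)\<^sup>*"
  using assms(1,3)
proof (induction "nat \<lfloor>matrix_dist n X A\<rfloor>" arbitrary: X rule: less_induct)
  case less
  show ?case
  proof (cases "X = A")
    case False
    then obtain u v where uv: "u \<in> indices n" "v \<in> indices n"
        and Y: "X + swap_matrix 1 u v \<in> nat_matrices n"
        and dist: "matrix_dist n (X + swap_matrix 1 u v) A \<le> matrix_dist n X A - 2"
      using exists_swap_reducing_dist[OF less.prems(1) A less.prems(2)] by blast
    let ?Y = "X + swap_matrix 1 u v"
    have "0 \<le> matrix_dist n ?Y A" unfolding matrix_dist_def by (auto intro!: sum_nonneg)
    then have "nat \<lfloor>matrix_dist n ?Y A\<rfloor> < nat \<lfloor>matrix_dist n X A\<rfloor>" using dist by linarith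
    moreover have "same_margins n ?Y A"
      using same_margins_swap[OF uv, of X] less.prems(2) by (simp add: same_margins_def)
    ultimately have "(?Y, A) \<in> (swap_step n)\<^sup>*" using Y less.hyps by blast
    moreover have "(X, ?Y) \<in> swap_step n" using uv Y unfolding swap_step_def by blast
    ultimately show ?thesis by (rule converse_rtrancl_into_rtrancl[rotated])
  qed simp
qed

section \<open>Swaps from the universal matrix\<close>

theorem corollary6p5:
  fixes n :: nat and \<omega> :: complex and A :: "nat \<Rightarrow> nat \<Rightarrow> real"
  assumes "n \<ge> 1"
    and "primitive_root_of_unity n \<omega>"
    and "A \<in> CSP_int n \<omega>"
  shows "\<exists>(t :: nat) (u :: nat \<Rightarrow> nat \<times> nat) (v :: nat \<Rightarrow> nat \<times> nat).
    (\<forall>r \<in> {1..t}. u r \<in> indices n \<and> v r \<in> indices n) \<and>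
    A = universal_matrix n (column_sum n A) + (\<Sum>r = 1..t. swap_matrix 1 (u r) (v r)) \<and>
    (\<forall>t0 \<in> {1..t}.
      universal_matrix n (column_sum n A) + (\<Sum>r = 1..t0. swap_matrix 1 (u r) (v r))
        \<in> CSP_int n \<omega>)"
proof -
  let ?U = "universal_matrix n (column_sum n A)"
  have U: "?U \<in> nat_matrices n" using universal_matrix_nat_matrices[OF assms(2,3,1)] .
  have margins: "same_margins n A ?U" using universal_matrix_same_margins[OF assms(2,3)] .
  have "(?U, A) \<in> (swap_step n)\<^sup>*"
    using U margins assms(3) by (intro swap_connected) (auto simp: CSP_int_iff_margins same_margins_def)
  \<comment> \<open>unfold the chain of steps into a sequence of matrices \<open>f\<close> and choose the swaps between them\<close>
  then obtain t where "(?U, A) \<in> swap_step n ^^ t" by (meson rtrancl_imp_relpow)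
  then obtain f where f: "f 0 = ?U" "f t = A" "\<And>r. r < t \<Longrightarrow> (f r, f (Suc r)) \<in> swap_step n"
    by (auto simp: relpow_fun_conv)
  have "\<forall>r \<in> {1..t}. \<exists>u v. u \<in> indices n \<and> v \<in> indices n \<and> f r = f (r - 1) + swap_matrix 1 u v
      \<and> f r \<in> nat_matrices n"
  proof
    fix r assume "r \<in> {1..t}"
    then have "r - 1 < t" "Suc (r - 1) = r" by auto
    then have "(f (r - 1), f r) \<in> swap_step n" using f(3) by metis
    then show "\<exists>u v. u \<in> indices n \<and> v \<in> indices n \<and> f r = f (r - 1) + swap_matrix 1 u v
        \<and> f r \<in> nat_matrices n"
      unfolding swap_step_def mem_Collect_eq prod.case by blast
  qed
  then obtain u v where uv: "\<forall>r \<in> {1..t}. u r \<in> indices n \<and> v r \<in> indices n \<and>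
      f r = f (r - 1) + swap_matrix 1 (u r) (v r) \<and> f r \<in> nat_matrices n"
    unfolding bchoice_iff by blast
  have partial: "f s = ?U + (\<Sum>r = 1..s. swap_matrix 1 (u r) (v r)) \<and> f s \<in> CSP_int n \<omega>"
    if "s \<le> t" for s
    using that
  proof (induction s)
    case 0
    then show ?case using f(1) CSP_int_same_margins[OF assms(3) U margins] by (simp add: zero_fun_def)
  next
    case (Suc s)
    from bspec[OF uv, of "Suc s"] Suc.prems have step: "u (Suc s) \<in> indices n" "v (Suc s) \<in> indices n"
        "f (Suc s) = f s + swap_matrix 1 (u (Suc s)) (v (Suc s))" "f (Suc s) \<in> nat_matrices n"
      by auto
    have margins: "same_margins n (f s) (f (Suc s))" using same_margins_swap[OF step(1,2)] step(3) by simp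
    have IH: "f s = ?U + (\<Sum>r = 1..s. swap_matrix 1 (u r) (v r))" "f s \<in> CSP_int n \<omega>"
      using Suc.IH[OF Suc_leD[OF Suc.prems]] by blast+
    have "f (Suc s) \<in> CSP_int n \<omega>" using CSP_int_same_margins[OF IH(2) step(4) margins] .
    moreover have "f (Suc s) = ?U + (\<Sum>r = 1..Suc s. swap_matrix 1 (u r) (v r))"
      unfolding step(3) IH(1) by (simp add: add.assoc)
    ultimately show ?case by blast
  qed
  have "\<forall>r \<in> {1..t}. u r \<in> indices n \<and> v r \<in> indices n" using uv by blast
  moreover have "A = ?U + (\<Sum>r = 1..t. swap_matrix 1 (u r) (v r))"
    using partial[of t] f(2) by simp
  moreover have "\<forall>t0 \<in> {1..t}. ?U + (\<Sum>r = 1..t0. swap_matrix 1 (u r) (v r)) \<in> CSP_int n \<omega>"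
    using partial by (metis atLeastAtMost_iff)
  ultimately show ?thesis by blast
qed

end
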